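(* Let $L\in\mathbb{R}^{n\times n}$ be the graph Laplacian matrix of a simple, connected, undirected graph on $n$ vertices. Let $(\lambda_1,\mathbf{v}_1),\ldots,(\lambda_c,\mathbf{v}_c)$ be eigenpairs of $L$ with $\lambda_j>0$ and $\mathbf{v}_1,\dots,\mathbf{v}_c\in\mathbb{R}^n$ orthonormal, let $V=[\mathbf{v}_1\ \cdots\ \mathbf{v}_c]\in\mathbb{R}^{n\times c}$, let $\delta>0$, and set $\widetilde{L}:=L+\delta VV^{\top}$. Then: (i) $\widetilde{L}$ is symmetric positive semi-definite with $\mathrm{null}(\widetilde{L})=\mathrm{span}\{\mathbf{1}_n\}$. (ii) The deflated eigenvalue problem $\widetilde{L}\mathbf{x}=(L+\delta VV^{\top})\mathbf{x}=\lambda\mathbf{x}$ preserves all eigenpairs of $L\mathbf{x}=\lambda\mathbf{x}$ except those with eigenvalue in $\{\lambda_1,\ldots,\lambda_c\}$, that is, every eigenpair $(\mu,\mathbf{u})$ of $L$ with $\mu\notin\{\lambda_1,\ldots,\lambda_c\}$ is an eigenpair of $\widetilde{L}$. Instead, these eigenvalues are transformed into $\lambda_j+\delta$: for each $j=1,\ldots,c$, $\lambda_j+\delta$ is an eigenvalue of $\widetilde{L}$ associated with the same eigenvector $\mathbf{v}_j$.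
   Context: The graph Laplacian matrix of a simple undirected graph $\mathcal{G}=(\mathcal{V},\mathcal{E})$ with $n$ vertices is $L=D-A$, where $A$ is the adjacency matrix ($A_{jk}=1$ if $jk\in\mathcal{E}$ and $0$ otherwise) and $D$ is the diagonal matrix with $D_{jj}=\sum_{k}A_{jk}$. $\mathbf{1}_n\in\mathbb{R}^n$ denotes the all-ones vector. For a connected graph, $L$ is symmetric positive semi-definite and its kernel is spanned by $\mathbf{1}_n$. *)

theory Defs
  imports "Graph_Theory.Graph_Theory" "HOL-Analysis.Analysis"
begin

text \<open>
  A simple undirected graph is a \<open>pair_graph\<close>, i.e. a finite set of vertices with a
  symmetric, irreflexive set of arcs, each undirected edge \<open>jk\<close> being the two arcs
  \<open>(j, k)\<close> and \<open>(k, j)\<close>. In the matrices below, rows and columns are indexed by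
  the type \<open>'n\<close>; they are the usual ones when \<open>pverts G = UNIV\<close>.
\<close>

definition adjacency_matrix :: "'n::finite pair_pre_digraph \<Rightarrow> real^'n^'n" where
  "adjacency_matrix G = (\<chi> j k. if (j, k) \<in> parcs G then 1 else 0)"

definition degree_matrix :: "'n::finite pair_pre_digraph \<Rightarrow> real^'n^'n" where
  "degree_matrix G =
     (\<chi> j k. if j = k then (\<Sum>l\<in>UNIV. adjacency_matrix G $ j $ l) else 0)"

definition laplacian_matrix :: "'n::finite pair_pre_digraph \<Rightarrow> real^'n^'n" where
  "laplacian_matrix G = degree_matrix G - adjacency_matrix G"

definition eigenpair :: "real^'n^'n \<Rightarrow> real \<Rightarrow> real^'n \<Rightarrow> bool" where
  "eigenpair A \<mu> u \<longleftrightarrow> u \<noteq> 0 \<and> A *v u = \<mu> *\<^sub>R u"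

definition symmetric_matrix :: "real^'n^'n \<Rightarrow> bool" where
  "symmetric_matrix A \<longleftrightarrow> transpose A = A"

definition sym_pos_semidef :: "real^'n^'n \<Rightarrow> bool" where
  "sym_pos_semidef A \<longleftrightarrow> symmetric_matrix A \<and> (\<forall>x. x \<bullet> (A *v x) \<ge> 0)"

definition null_space :: "real^'n^'m \<Rightarrow> (real^'n) set" where
  "null_space A = {x. A *v x = 0}"

definition orthonormal_family :: "('c \<Rightarrow> real^'n) \<Rightarrow> bool" where
  "orthonormal_family v \<longleftrightarrow> (\<forall>i j. v i \<bullet> v j = (if i = j then 1 else 0))"

definition matrix_of_columns :: "('c \<Rightarrow> real^'n) \<Rightarrow> real^'c^'n" where
  "matrix_of_columns v = (\<chi> i j. v j $ i)"

end

theory Submission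
  imports Defs
begin

text \<open>
  The correction \<open>V V\<^sup>T\<close> acts as \<open>x \<mapsto> \<Sum>j. (v\<^sub>j \<bullet> x) v\<^sub>j\<close>, which sends \<open>v\<^sub>j\<close> to itself by
  orthonormality and annihilates every vector orthogonal to all the \<open>v\<^sub>j\<close>. Part (ii) is therefore a
  matter of orthogonality: eigenvectors of a symmetric matrix for different eigenvalues are
  orthogonal, so an eigenpair of \<open>L\<close> with eigenvalue outside \<open>{\<lambda>\<^sub>1, \<dots>, \<lambda>\<^sub>c}\<close> does not see the
  correction (\<open>eigenpair_deflation_other\<close>), while \<open>v\<^sub>j\<close> has its eigenvalue raised by \<open>\<delta>\<close>
  (\<open>eigenpair_deflation_shifted\<close>).

  For part (i), the quadratic form of \<open>L + \<delta> V V\<^sup>T\<close> is that of \<open>L\<close> plus \<open>\<delta>\<close> times a sum of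
  squares, and that of \<open>L\<close> is half the sum of \<open>(x\<^sub>i - x\<^sub>k)\<^sup>2\<close> over all arcs
  (\<open>laplacian_quadratic_form\<close>). This gives semi-definiteness. A null vector \<open>x\<close> makes
  both parts vanish; since the graph is connected, vanishing of the first forces
  \<open>x\<close> to be constant. Conversely \<open>(0, 1)\<close> is an eigenpair of \<open>L\<close>, and \<open>0\<close> is not among the positive
  numbers \<open>\<lambda>\<^sub>j\<close>, so part (ii) keeps the all-ones vector in the null space.
\<close>

lemma symmetric_matrix_inner:
  fixes A :: "real^'n^'n"
  assumes "symmetric_matrix A"
  shows "(A *v x) \<bullet> y = x \<bullet> (A *v y)"
  using assms unfolding symmetric_matrix_def
  by (metis dot_lmul_matrix vector_transpose_matrix)

lemma symmetric_eigenvectors_orthogonal: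
  assumes "symmetric_matrix A" "eigenpair A \<mu> u" "eigenpair A \<nu> w" "\<mu> \<noteq> \<nu>"
  shows "u \<bullet> w = 0"
proof -
  have "\<mu> * (u \<bullet> w) = \<nu> * (u \<bullet> w)"
    using symmetric_matrix_inner[OF assms(1), of u w] assms(2,3)
    by (simp add: eigenpair_def)
  then show ?thesis using assms(4) by simp
qed

lemma columns_mult_transpose_vector:
  fixes v :: "'c::finite \<Rightarrow> real^'n"
  shows "(matrix_of_columns v ** transpose (matrix_of_columns v)) *v x
         = (\<Sum>j\<in>UNIV. (v j \<bullet> x) *\<^sub>R v j)"
  unfolding matrix_vector_mul_assoc[symmetric]
  by (simp add: vec_eq_iff matrix_vector_mult_def matrix_of_columns_def transpose_def
      inner_vec_def mult.commute)

lemma deflation_mult_vector: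
  fixes v :: "'c::finite \<Rightarrow> real^'n"
  shows "(A + \<delta> *\<^sub>R (matrix_of_columns v ** transpose (matrix_of_columns v))) *v x
         = A *v x + \<delta> *\<^sub>R (\<Sum>j\<in>UNIV. (v j \<bullet> x) *\<^sub>R v j)"
  by (simp add: matrix_vector_mult_add_rdistrib columns_mult_transpose_vector
      scaleR_matrix_vector_assoc[symmetric])

lemma symmetric_deflation:
  fixes v :: "'c::finite \<Rightarrow> real^'n"
  assumes "symmetric_matrix A"
  shows "symmetric_matrix (A + \<delta> *\<^sub>R (matrix_of_columns v ** transpose (matrix_of_columns v)))"
  using assms
  by (simp add: symmetric_matrix_def vec_eq_iff transpose_def matrix_matrix_mult_def mult.commute)

lemma deflation_quadratic_form:
  fixes v :: "'c::finite \<Rightarrow> real^'n"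
  shows "x \<bullet> ((A + \<delta> *\<^sub>R (matrix_of_columns v ** transpose (matrix_of_columns v))) *v x)
         = x \<bullet> (A *v x) + \<delta> * (\<Sum>j\<in>UNIV. (v j \<bullet> x)\<^sup>2)"
  by (simp add: deflation_mult_vector inner_add_right inner_sum_right power2_eq_square
      inner_commute[of x])

lemma eigenpair_deflation_other:
  fixes v :: "'c::finite \<Rightarrow> real^'n"
  assumes "symmetric_matrix A" "\<And>j. eigenpair A (lam j) (v j)"
    and "eigenpair A \<mu> u" "\<mu> \<notin> range lam"
  shows "eigenpair (A + \<delta> *\<^sub>R (matrix_of_columns v ** transpose (matrix_of_columns v))) \<mu> u"
proof -
  have "v j \<bullet> u = 0" for j
    using symmetric_eigenvectors_orthogonal[OF assms(1) assms(2)[of j] assms(3)] assms(4) by auto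
  then show ?thesis using assms(3) by (simp add: eigenpair_def deflation_mult_vector)
qed

lemma eigenpair_deflation_shifted:
  fixes v :: "'c::finite \<Rightarrow> real^'n"
  assumes "orthonormal_family v" "eigenpair A \<nu> (v j)"
  shows "eigenpair (A + \<delta> *\<^sub>R (matrix_of_columns v ** transpose (matrix_of_columns v)))
           (\<nu> + \<delta>) (v j)"
proof -
  have "(\<Sum>i\<in>UNIV. (v i \<bullet> v j) *\<^sub>R v i) = (\<Sum>i\<in>UNIV. if i = j then v i else 0)"
    using assms(1) by (intro sum.cong) (auto simp: orthonormal_family_def)
  also have "\<dots> = v j" by simp
  finally show ?thesis
    using assms(2) by (simp add: eigenpair_def deflation_mult_vector scaleR_add_left)
qed

lemma adjacency_matrix_symmetric:
  assumes "pair_graph G"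
  shows "adjacency_matrix G $ i $ k = adjacency_matrix G $ k $ i"
proof -
  interpret pair_graph G by fact
  show ?thesis
    using sym_arcs by (auto simp: adjacency_matrix_def symmetric_def sym_def)
qed

lemma laplacian_symmetric:
  assumes "pair_graph G"
  shows "symmetric_matrix (laplacian_matrix G)"
  using adjacency_matrix_symmetric[OF assms]
  by (simp add: symmetric_matrix_def laplacian_matrix_def degree_matrix_def transpose_def
      vec_eq_iff)

lemma laplacian_mult_component:
  "(laplacian_matrix G *v x) $ i = (\<Sum>k\<in>UNIV. adjacency_matrix G $ i $ k * (x $ i - x $ k))"
proof -
  have "(degree_matrix G *v x) $ i
      = (\<Sum>k\<in>UNIV. if k = i then (\<Sum>l\<in>UNIV. adjacency_matrix G $ i $ l) * x $ k else 0)"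
    unfolding matrix_vector_mult_def degree_matrix_def vec_lambda_beta
    by (rule sum.cong) simp_all
  also have "\<dots> = (\<Sum>k\<in>UNIV. adjacency_matrix G $ i $ k * x $ i)"
    by (simp add: sum_distrib_right)
  finally show ?thesis
    by (simp add: laplacian_matrix_def matrix_vector_mult_diff_rdistrib right_diff_distrib
        sum_subtractf) (simp add: matrix_vector_mult_def)
qed

text \<open>
  Exchanging the names of the two ends of every arc turns the factor \<open>x\<^sub>i\<close> in \<open>x \<bullet> L x\<close> into
  \<open>- x\<^sub>k\<close>; averaging the two expressions completes the square.
\<close>
lemma laplacian_quadratic_form:
  assumes "pair_graph G"
  shows "2 * (x \<bullet> (laplacian_matrix G *v x))
         = (\<Sum>i\<in>UNIV. \<Sum>k\<in>UNIV. adjacency_matrix G $ i $ k * (x $ i - x $ k)\<^sup>2)"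
proof -
  let ?a = "\<lambda>i k. adjacency_matrix G $ i $ k"
  let ?q = "x \<bullet> (laplacian_matrix G *v x)"
  have 1: "?q = (\<Sum>i\<in>UNIV. \<Sum>k\<in>UNIV. ?a i k * (x $ i - x $ k) * x $ i)"
    by (simp add: inner_vec_def laplacian_mult_component sum_distrib_left mult_ac)
  also have "\<dots> = (\<Sum>i\<in>UNIV. \<Sum>k\<in>UNIV. ?a k i * (x $ k - x $ i) * x $ k)"
    by (rule sum.swap)
  also have "\<dots> = (\<Sum>i\<in>UNIV. \<Sum>k\<in>UNIV. ?a i k * (x $ k - x $ i) * x $ k)"
    by (simp add: adjacency_matrix_symmetric[OF assms, of k i for k i])
  finally have 2: "?q = \<dots>" .
  have "2 * ?q = ?q + ?q" by simp
  also have "\<dots> = (\<Sum>i\<in>UNIV. \<Sum>k\<in>UNIV.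
      ?a i k * (x $ i - x $ k) * x $ i + ?a i k * (x $ k - x $ i) * x $ k)"
    unfolding sum.distrib using 1 2 by simp
  also have "\<dots> = (\<Sum>i\<in>UNIV. \<Sum>k\<in>UNIV. ?a i k * (x $ i - x $ k)\<^sup>2)"
    by (intro sum.cong refl) (simp add: power2_eq_square algebra_simps)
  finally show ?thesis .
qed

lemma laplacian_quadratic_form_nonneg:
  assumes "pair_graph G"
  shows "x \<bullet> (laplacian_matrix G *v x) \<ge> 0"
proof -
  have "0 \<le> 2 * (x \<bullet> (laplacian_matrix G *v x))"
    unfolding laplacian_quadratic_form[OF assms]
    by (intro sum_nonneg) (simp add: adjacency_matrix_def)
  then show ?thesis by simp
qed

lemma laplacian_quadratic_form_eq_0_imp_arc:
  assumes "pair_graph G" "x \<bullet> (laplacian_matrix G *v x) = 0" "(i, k) \<in> parcs G"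
  shows "x $ i = x $ k"
proof -
  let ?f = "\<lambda>i k. adjacency_matrix G $ i $ k * (x $ i - x $ k)\<^sup>2"
  have nonneg: "?f i k \<ge> 0" for i k by (simp add: adjacency_matrix_def)
  have "(\<Sum>i\<in>UNIV. \<Sum>k\<in>UNIV. ?f i k) = 0"
    using laplacian_quadratic_form[OF assms(1), of x] assms(2) by simp
  then have "\<forall>i. (\<Sum>k\<in>UNIV. ?f i k) = 0"
    by (simp add: sum_nonneg_eq_0_iff sum_nonneg nonneg)
  then have "?f i k = 0"
    by (simp add: sum_nonneg_eq_0_iff nonneg)
  then show ?thesis using assms(3) by (simp add: adjacency_matrix_def)
qed

lemma connected_constant:
  assumes "Digraph_Component.connected (with_proj G)" "u \<in> pverts G" "w \<in> pverts G"
    and "\<And>i k. (i, k) \<in> parcs G \<Longrightarrow> f i = f k"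
  shows "f u = f w"
proof -
  have "(u, w) \<in> rtrancl_on (pverts G) ((parcs G)\<^sup>s)"
    using assms(1-3) unfolding connected_conv by simp
  then show ?thesis
  proof (induction rule: rtrancl_on_induct)
    case (step y z)
    then show ?case using assms(4)[of y z] assms(4)[of z y] by (auto simp: symcl_def)
  qed simp
qed

lemma laplacian_quadratic_form_eq_0_imp_span:
  fixes x :: "real^'n"
  assumes "pair_graph G" "pverts G = UNIV" "Digraph_Component.connected (with_proj G)"
    and "x \<bullet> (laplacian_matrix G *v x) = 0"
  shows "x \<in> span {\<chi> i. 1}"
proof -
  have "x $ i = x $ k" for i k
    using connected_constant[OF assms(3), where f = "($) x"] assms(2)
      laplacian_quadratic_form_eq_0_imp_arc[OF assms(1,4)] by simp
  then have "x = (x $ undefined) *\<^sub>R (\<chi> i. 1)" by (simp add: vec_eq_iff)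
  then show ?thesis by (metis span_base span_scale singletonI)
qed

lemma eigenpair_laplacian_ones: "eigenpair (laplacian_matrix G) 0 (\<chi> i. 1)"
  by (simp add: eigenpair_def vec_eq_iff laplacian_mult_component)

theorem theorem2p5:
  fixes G :: "'n::finite pair_pre_digraph"
    and L Lt :: "real^'n^'n"
    and lam :: "'c::finite \<Rightarrow> real"
    and v :: "'c \<Rightarrow> real^'n"
    and V :: "real^'c^'n"
    and \<delta> :: real
  assumes "pair_graph G"
    and "pverts G = UNIV"
    and "Digraph_Component.connected (with_proj G)"
    and "L = laplacian_matrix G"
    and "\<And>j. eigenpair L (lam j) (v j)"
    and "\<And>j. lam j > 0"
    and "orthonormal_family v"
    and "V = matrix_of_columns v"
    and "\<delta> > 0"
    and "Lt = L + \<delta> *\<^sub>R (V ** transpose V)"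
  shows "sym_pos_semidef Lt \<and> null_space Lt = span {\<chi> i. 1} \<and>
         (\<forall>\<mu> u. eigenpair L \<mu> u \<and> \<mu> \<notin> range lam \<longrightarrow> eigenpair Lt \<mu> u) \<and>
         (\<forall>j. eigenpair Lt (lam j + \<delta>) (v j))"
proof -
  note Lt = assms(10)[unfolded assms(8)]
  have sym: "symmetric_matrix L"
    using laplacian_symmetric[OF assms(1)] assms(4) by simp
  have quad: "x \<bullet> (Lt *v x) = x \<bullet> (L *v x) + \<delta> * (\<Sum>j\<in>UNIV. (v j \<bullet> x)\<^sup>2)" for x
    unfolding Lt by (rule deflation_quadratic_form)
  have L_nonneg: "x \<bullet> (L *v x) \<ge> 0" for x
    unfolding assms(4) by (rule laplacian_quadratic_form_nonneg[OF assms(1)])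
  have correction_nonneg: "\<delta> * (\<Sum>j\<in>UNIV. (v j \<bullet> x)\<^sup>2) \<ge> 0" for x
    using assms(9) by (simp add: sum_nonneg)
  have other: "eigenpair Lt \<mu> u" if "eigenpair L \<mu> u" "\<mu> \<notin> range lam" for \<mu> u
    unfolding Lt by (rule eigenpair_deflation_other[OF sym assms(5) that])
  have shifted: "eigenpair Lt (lam j + \<delta>) (v j)" for j
    unfolding Lt by (rule eigenpair_deflation_shifted[OF assms(7,5)])
  have psd: "sym_pos_semidef Lt"
    using symmetric_deflation[OF sym] L_nonneg correction_nonneg
    by (simp add: sym_pos_semidef_def quad) (simp add: Lt)
  have "null_space Lt \<subseteq> span {\<chi> i. 1}"
  proof
    fix x assume "x \<in> null_space Lt"
    then have "x \<bullet> (Lt *v x) = 0" by (simp add: null_space_def)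
    then have "x \<bullet> (L *v x) = 0"
      using quad[of x] L_nonneg[of x] correction_nonneg[of x] by linarith
    then show "x \<in> span {\<chi> i. 1}"
      unfolding assms(4) by (rule laplacian_quadratic_form_eq_0_imp_span[OF assms(1-3)])
  qed
  moreover have "span {\<chi> i. 1} \<subseteq> null_space Lt"
  proof -
    have "0 \<notin> range lam" using assms(6) by (metis imageE less_irrefl)
    then have "eigenpair Lt 0 (\<chi> i. 1)"
      using other eigenpair_laplacian_ones assms(4) by blast
    then show ?thesis
      by (auto simp: eigenpair_def null_space_def span_singleton matrix_vector_mult_scaleR)
  qed
  ultimately show ?thesis using psd other shifted by blast
qed

end
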